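(* Let $k$ be a field and let $R$ be an almost PI $k$-algebra. Then $R$ has a countable cofinal subset of ideals. Therefore $R$ has a countable separating set for its nonzero ideals.
   Context: All algebras are associative with 1. PI means satisfying a (nontrivial) polynomial identity over $k$. A $k$-algebra $R$ is almost PI if $R$ is not PI and $R/I$ is PI for every nonzero two-sided ideal $I$ of $R$; such an algebra is prime. A countable cofinal subset of ideals of a prime ring is a countable collection of nonzero two-sided ideals such that every nonzero two-sided ideal contains an ideal in the collection. A separating set for the nonzero ideals of $R$ is a subset $S\subseteq R$ with $0\notin S$ such that $I\cap S\neq\emptyset$ for every nonzero two-sided ideal $I$ of $R$. Countable means of cardinality at most $\aleph_0$. *)

theory Defs
  imports "HOL-Algebra.Algebra" "HOL-Library.Countable_Set"
begin

text \<open>The library locale \<^locale>\<open>algebra\<close> only covers commutative algebras. As there, the algebra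
  is a \<^locale>\<open>module\<close> whose underlying record also carries the ring structure.\<close>

locale assoc_algebra = module K A + scalars?: field K + ring A
  for K :: "('k, 'm) ring_scheme" (structure) and A :: "('k, 'a, 'n) module_scheme" (structure) +
  assumes smult_mult_left:
      "\<lbrakk>c \<in> carrier K; x \<in> carrier A; y \<in> carrier A\<rbrakk>
        \<Longrightarrow> (c \<odot>\<^bsub>A\<^esub> x) \<otimes>\<^bsub>A\<^esub> y = c \<odot>\<^bsub>A\<^esub> (x \<otimes>\<^bsub>A\<^esub> y)"
    and smult_mult_right:
      "\<lbrakk>c \<in> carrier K; x \<in> carrier A; y \<in> carrier A\<rbrakk>
        \<Longrightarrow> x \<otimes>\<^bsub>A\<^esub> (c \<odot>\<^bsub>A\<^esub> y) = c \<odot>\<^bsub>A\<^esub> (x \<otimes>\<^bsub>A\<^esub> y)"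

text \<open>The ring \<^term>\<open>A Quot I\<close> with the induced scalar action. The scalar multiplication is written
  like \<^const>\<open>rcoset_mult\<close>; the lemma \<open>quotient_algebra_smult\<close> below gives the usual formula.
  For a unital algebra every two-sided ring ideal is a subspace, so \<^const>\<open>ideal\<close> is the
  right notion of ideal.\<close>

definition quotient_algebra ::
    "('k, 'a, 'n) module_scheme \<Rightarrow> 'a set \<Rightarrow> ('k, 'a set) module"  (infixl \<open>QuotAlg\<close> 65) where
  "A QuotAlg I =
    ring.extend (A Quot I) (module.fields (\<lambda>c B. \<Union>x\<in>B. I +>\<^bsub>A\<^esub> (c \<odot>\<^bsub>A\<^esub> x)))"

text \<open>An element of the free algebra over \<open>K\<close> on noncommuting variables \<open>X\<^sub>0, X\<^sub>1, \<dots>\<close> is its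
  coefficient function: the word \<open>[i\<^sub>1, \<dots>, i\<^sub>r]\<close> stands for the monomial
  \<open>X\<^bsub>i\<^sub>1\<^esub> \<cdots> X\<^bsub>i\<^sub>r\<^esub>\<close>, the empty word for \<open>1\<close>.\<close>

definition nc_polys :: "('k, 'm) ring_scheme \<Rightarrow> (nat list \<Rightarrow> 'k) set" where
  "nc_polys K = {f. (\<forall>w. f w \<in> carrier K) \<and> finite {w. f w \<noteq> \<zero>\<^bsub>K\<^esub>}}"

definition word_eval :: "('a, 'n) ring_scheme \<Rightarrow> (nat \<Rightarrow> 'a) \<Rightarrow> nat list \<Rightarrow> 'a" where
  "word_eval A x w = foldr (\<lambda>i y. x i \<otimes>\<^bsub>A\<^esub> y) w \<one>\<^bsub>A\<^esub>"

definition nc_eval ::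
    "('k, 'm) ring_scheme \<Rightarrow> ('k, 'a, 'n) module_scheme \<Rightarrow> (nat list \<Rightarrow> 'k) \<Rightarrow> (nat \<Rightarrow> 'a) \<Rightarrow> 'a" where
  "nc_eval K A f x = (\<Oplus>\<^bsub>A\<^esub>w\<in>{w. f w \<noteq> \<zero>\<^bsub>K\<^esub>}. f w \<odot>\<^bsub>A\<^esub> word_eval A x w)"

definition polynomial_identity ::
    "('k, 'm) ring_scheme \<Rightarrow> ('k, 'a, 'n) module_scheme \<Rightarrow> (nat list \<Rightarrow> 'k) \<Rightarrow> bool" where
  "polynomial_identity K A f \<longleftrightarrow>
    f \<in> nc_polys K \<and> (\<forall>x \<in> UNIV \<rightarrow> carrier A. nc_eval K A f x = \<zero>\<^bsub>A\<^esub>)"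

text \<open>The zero algebra is PI.\<close>

definition PI_algebra :: "('k, 'm) ring_scheme \<Rightarrow> ('k, 'a, 'n) module_scheme \<Rightarrow> bool" where
  "PI_algebra K A \<longleftrightarrow> assoc_algebra K A \<and> (\<exists>f. f \<noteq> (\<lambda>w. \<zero>\<^bsub>K\<^esub>) \<and> polynomial_identity K A f)"

definition nonzero_ideals :: "('a, 'n) ring_scheme \<Rightarrow> 'a set set" where
  "nonzero_ideals R = {I. ideal I R \<and> I \<noteq> {\<zero>\<^bsub>R\<^esub>}}"

definition almost_PI :: "('k, 'm) ring_scheme \<Rightarrow> ('k, 'a, 'n) module_scheme \<Rightarrow> bool" where
  "almost_PI K R \<longleftrightarrow>
    assoc_algebra K R \<and> \<not> PI_algebra K R \<and> (\<forall>I \<in> nonzero_ideals R. PI_algebra K (R QuotAlg I))"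

definition countable_cofinal_ideals :: "('a, 'n) ring_scheme \<Rightarrow> 'a set set \<Rightarrow> bool" where
  "countable_cofinal_ideals R \<C> \<longleftrightarrow>
    countable \<C> \<and> \<C> \<subseteq> nonzero_ideals R \<and> (\<forall>J \<in> nonzero_ideals R. \<exists>I \<in> \<C>. I \<subseteq> J)"

definition separating_set :: "('a, 'n) ring_scheme \<Rightarrow> 'a set \<Rightarrow> bool" where
  "separating_set R S \<longleftrightarrow>
    S \<subseteq> carrier R \<and> \<zero>\<^bsub>R\<^esub> \<notin> S \<and> (\<forall>I \<in> nonzero_ideals R. I \<inter> S \<noteq> {})"

lemma (in assoc_algebra) quotient_algebra_smult:
  assumes "ideal I A" "c \<in> carrier K" "x \<in> carrier A"
  shows "c \<odot>\<^bsub>A QuotAlg I\<^esub> (I +>\<^bsub>A\<^esub> x) = I +>\<^bsub>A\<^esub> (c \<odot>\<^bsub>A\<^esub> x)"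
proof -
  interpret I: ideal I A by fact
  have "I +>\<^bsub>A\<^esub> (c \<odot>\<^bsub>A\<^esub> y) = I +>\<^bsub>A\<^esub> (c \<odot>\<^bsub>A\<^esub> x)" if y: "y \<in> I +>\<^bsub>A\<^esub> x" for y
  proof -
    obtain h where h: "h \<in> I" "y = h \<oplus>\<^bsub>A\<^esub> x"
      using y by (auto simp: a_r_coset_def')
    have hA: "h \<in> carrier A" using h I.a_Hcarr by blast
    have "c \<odot>\<^bsub>A\<^esub> h = (c \<odot>\<^bsub>A\<^esub> \<one>\<^bsub>A\<^esub>) \<otimes>\<^bsub>A\<^esub> h"
      using smult_mult_left[of c "\<one>\<^bsub>A\<^esub>" h] assms hA by simp
    hence "c \<odot>\<^bsub>A\<^esub> h \<in> I"
      using I.I_l_closed[OF h(1), of "c \<odot>\<^bsub>A\<^esub> \<one>\<^bsub>A\<^esub>"] assms by simp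
    moreover have "c \<odot>\<^bsub>A\<^esub> y = c \<odot>\<^bsub>A\<^esub> h \<oplus>\<^bsub>A\<^esub> c \<odot>\<^bsub>A\<^esub> x"
      using h hA assms smult_r_distr by simp
    ultimately have "c \<odot>\<^bsub>A\<^esub> y \<in> I +>\<^bsub>A\<^esub> (c \<odot>\<^bsub>A\<^esub> x)"
      by (auto simp: a_r_coset_def')
    thus ?thesis
      using I.a_repr_independence'[of "c \<odot>\<^bsub>A\<^esub> y" "c \<odot>\<^bsub>A\<^esub> x"] assms by simp
  qed
  hence "(\<Union>y\<in>I +>\<^bsub>A\<^esub> x. I +>\<^bsub>A\<^esub> (c \<odot>\<^bsub>A\<^esub> y)) = I +>\<^bsub>A\<^esub> (c \<odot>\<^bsub>A\<^esub> x)"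
    using I.a_rcos_self[OF assms(3)] by blast
  thus ?thesis by (simp add: quotient_algebra_def ring.defs module.defs)
qed

lemma (in assoc_algebra) assoc_algebra_quotient:
  assumes "ideal I A"
  shows "assoc_algebra K (A QuotAlg I)"
proof -
  interpret I: ideal I A by fact
  interpret Q: ring "A Quot I" by (rule I.quotient_is_ring)
  let ?Q = "A QuotAlg I"
  have ops: "carrier ?Q = {I +>\<^bsub>A\<^esub> x |x. x \<in> carrier A}"
    "\<And>B C. B \<otimes>\<^bsub>?Q\<^esub> C = B \<otimes>\<^bsub>A Quot I\<^esub> C" "\<And>B C. B \<oplus>\<^bsub>?Q\<^esub> C = B \<oplus>\<^bsub>A Quot I\<^esub> C"
    "\<zero>\<^bsub>?Q\<^esub> = \<zero>\<^bsub>A Quot I\<^esub>" "\<one>\<^bsub>?Q\<^esub> = \<one>\<^bsub>A Quot I\<^esub>"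
    and car: "carrier ?Q = carrier (A Quot I)"
    by (auto simp: quotient_algebra_def ring.defs module.defs FactRing_simps)
  have Qmult: "(I +>\<^bsub>A\<^esub> x) \<otimes>\<^bsub>?Q\<^esub> (I +>\<^bsub>A\<^esub> y) = I +>\<^bsub>A\<^esub> (x \<otimes>\<^bsub>A\<^esub> y)"
    if "x \<in> carrier A" "y \<in> carrier A" for x y
    using I.rcoset_mult_add[OF that] by (simp add: quotient_algebra_def ring.defs module.defs FactRing_def)
  have Qadd: "(I +>\<^bsub>A\<^esub> x) \<oplus>\<^bsub>?Q\<^esub> (I +>\<^bsub>A\<^esub> y) = I +>\<^bsub>A\<^esub> (x \<oplus>\<^bsub>A\<^esub> y)"
    if "x \<in> carrier A" "y \<in> carrier A" for x y
    using I.a_rcos_sum[OF that] by (simp add: quotient_algebra_def ring.defs module.defs FactRing_def)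
  have rQ: "ring ?Q"
  proof (rule ringI)
    show "abelian_group ?Q"
    proof (rule abelian_groupI, unfold ops(2-) car)
      show "\<exists>C\<in>carrier (A Quot I). C \<oplus>\<^bsub>A Quot I\<^esub> B = \<zero>\<^bsub>A Quot I\<^esub>" if "B \<in> carrier (A Quot I)" for B
        using that Q.a_inv_closed Q.l_neg by blast
    qed (simp_all add: Q.a_assoc, simp add: Q.a_comm)
    show "Group.monoid ?Q"
      by (rule monoidI, unfold ops(2-) car) (simp_all add: Q.m_assoc)
  qed (unfold ops(2-) car, simp_all add: Q.l_distr Q.r_distr)
  interpret Q': ring ?Q by (rule rQ)
  note Qsmult = quotient_algebra_smult[OF assms]
  have repr: "\<exists>x\<in>carrier A. B = I +>\<^bsub>A\<^esub> x" if "B \<in> carrier ?Q" for B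
    using that ops(1) by blast
  have reprI: "I +>\<^bsub>A\<^esub> x \<in> carrier ?Q" if "x \<in> carrier A" for x
    using that ops(1) by blast
  have "module K ?Q"
  proof (rule moduleI[OF is_cring Q'.abelian_group_axioms])
    fix c d B C
    show "c \<odot>\<^bsub>?Q\<^esub> B \<in> carrier ?Q"
      if c: "c \<in> carrier K" and B: "B \<in> carrier ?Q"
    proof -
      obtain x where x: "x \<in> carrier A" "B = I +>\<^bsub>A\<^esub> x" using repr[OF B] by blast
      show ?thesis unfolding x(2) using c x(1) by (simp add: Qsmult reprI)
    qed
    show "(c \<oplus>\<^bsub>K\<^esub> d) \<odot>\<^bsub>?Q\<^esub> B = c \<odot>\<^bsub>?Q\<^esub> B \<oplus>\<^bsub>?Q\<^esub> d \<odot>\<^bsub>?Q\<^esub> B"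
      if cd: "c \<in> carrier K" "d \<in> carrier K" and B: "B \<in> carrier ?Q"
    proof -
      obtain x where x: "x \<in> carrier A" "B = I +>\<^bsub>A\<^esub> x" using repr[OF B] by blast
      show ?thesis unfolding x(2) using cd x(1) by (simp add: Qsmult Qadd smult_l_distr)
    qed
    show "c \<odot>\<^bsub>?Q\<^esub> (B \<oplus>\<^bsub>?Q\<^esub> C) = c \<odot>\<^bsub>?Q\<^esub> B \<oplus>\<^bsub>?Q\<^esub> c \<odot>\<^bsub>?Q\<^esub> C"
      if c: "c \<in> carrier K" and B: "B \<in> carrier ?Q" and C: "C \<in> carrier ?Q"
    proof -
      obtain x where x: "x \<in> carrier A" "B = I +>\<^bsub>A\<^esub> x" using repr[OF B] by blast
      obtain y where y: "y \<in> carrier A" "C = I +>\<^bsub>A\<^esub> y" using repr[OF C] by blast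
      show ?thesis unfolding x(2) y(2) using c x(1) y(1) by (simp add: Qsmult Qadd smult_r_distr)
    qed
    show "(c \<otimes>\<^bsub>K\<^esub> d) \<odot>\<^bsub>?Q\<^esub> B = c \<odot>\<^bsub>?Q\<^esub> (d \<odot>\<^bsub>?Q\<^esub> B)"
      if cd: "c \<in> carrier K" "d \<in> carrier K" and B: "B \<in> carrier ?Q"
    proof -
      obtain x where x: "x \<in> carrier A" "B = I +>\<^bsub>A\<^esub> x" using repr[OF B] by blast
      show ?thesis unfolding x(2) using cd x(1) by (simp add: Qsmult smult_assoc1)
    qed
    show "\<one>\<^bsub>K\<^esub> \<odot>\<^bsub>?Q\<^esub> B = B" if B: "B \<in> carrier ?Q"
    proof -
      obtain x where x: "x \<in> carrier A" "B = I +>\<^bsub>A\<^esub> x" using repr[OF B] by blast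
      show ?thesis unfolding x(2) using x(1) by (simp add: Qsmult)
    qed
  qed
  thus ?thesis
  proof (intro assoc_algebra.intro assoc_algebra_axioms.intro rQ scalars.field_axioms)
    fix c B C assume c: "c \<in> carrier K" and BC: "B \<in> carrier ?Q" "C \<in> carrier ?Q"
    obtain x where x: "x \<in> carrier A" "B = I +>\<^bsub>A\<^esub> x" using repr[OF BC(1)] by blast
    obtain y where y: "y \<in> carrier A" "C = I +>\<^bsub>A\<^esub> y" using repr[OF BC(2)] by blast
    show "(c \<odot>\<^bsub>?Q\<^esub> B) \<otimes>\<^bsub>?Q\<^esub> C = c \<odot>\<^bsub>?Q\<^esub> (B \<otimes>\<^bsub>?Q\<^esub> C)"
      unfolding x(2) y(2) using c x(1) y(1) by (simp add: Qsmult Qmult smult_mult_left)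
    show "B \<otimes>\<^bsub>?Q\<^esub> (c \<odot>\<^bsub>?Q\<^esub> C) = c \<odot>\<^bsub>?Q\<^esub> (B \<otimes>\<^bsub>?Q\<^esub> C)"
      unfolding x(2) y(2) using c x(1) y(1) by (simp add: Qsmult Qmult smult_mult_right)
  qed
qed

end

theory Submission
  imports Defs "HOL-Combinatorics.Permutations"
begin

text \<open>An identity of an algebra \<open>A\<close> whose support is the set of words \<open>W = {w\<^sub>1, \<dots>, w\<^sub>N}\<close> makes
  the values of these words in \<open>A\<close> linearly dependent. Hence the alternating sum over all
  permutations \<open>\<pi>\<close> of \<open>W\<close> of the products \<open>\<pi>(w\<^sub>1) y \<cdots> \<pi>(w\<^sub>N) y\<close>, where \<open>y\<close> is a new variable,
  vanishes on \<open>A\<close>. This is again an identity: the separator \<open>y\<close> keeps the monomials distinct, so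
  it is nonzero. As it depends on \<open>W\<close> only, and no longer on the coefficients of the given
  identity, there are countably many such identities. The two-sided ideals generated by their
  values in \<open>R\<close> are nonzero because \<open>R\<close> is not PI, and each nonzero ideal \<open>J\<close> contains one of them
  because \<open>R/J\<close> is PI.\<close>

section \<open>Alternating sums of separated products, and their noncommutative polynomials\<close>

definition separated_prod :: "('a, 'n) ring_scheme \<Rightarrow> 'a \<Rightarrow> 'a list \<Rightarrow> 'a" where
  "separated_prod A y vs = foldr (\<lambda>v r. v \<otimes>\<^bsub>A\<^esub> (y \<otimes>\<^bsub>A\<^esub> r)) vs \<one>\<^bsub>A\<^esub>"

text \<open>Even and odd permutations are collected separately, so that cancellation does not require
  division by \<open>2\<close>.\<close>

definition capelli :: "('a, 'n) ring_scheme \<Rightarrow> 'a \<Rightarrow> ('i \<Rightarrow> 'a) \<Rightarrow> 'i list \<Rightarrow> 'a" where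
  "capelli A y z is =
    (\<Oplus>\<^bsub>A\<^esub>\<pi>\<in>{\<pi>. \<pi> permutes set is \<and> evenperm \<pi>}. separated_prod A y (map (z \<circ> \<pi>) is)) \<ominus>\<^bsub>A\<^esub>
    (\<Oplus>\<^bsub>A\<^esub>\<pi>\<in>{\<pi>. \<pi> permutes set is \<and> \<not> evenperm \<pi>}. separated_prod A y (map (z \<circ> \<pi>) is))"

text \<open>The variable \<open>X\<^sub>0\<close> is the separator; the variables of the given words are shifted by one.\<close>

definition capelli_word :: "nat list list \<Rightarrow> (nat list \<Rightarrow> nat list) \<Rightarrow> nat list" where
  "capelli_word ws \<pi> = concat (map (\<lambda>w. map Suc (\<pi> w) @ [0]) ws)"

text \<open>Coefficient function whose evaluation is \<open>capelli\<close>. Since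
  \<open>capelli_word ws\<close> is injective on the permutations of \<open>set ws\<close>, no word
  satisfies both tests, so each monomial carries exactly the sign of its permutation.\<close>

definition capelli_poly :: "('k, 'm) ring_scheme \<Rightarrow> nat list list \<Rightarrow> nat list \<Rightarrow> 'k" where
  "capelli_poly K ws w =
    (if w \<in> capelli_word ws ` {\<pi>. \<pi> permutes set ws \<and> evenperm \<pi>} then \<one>\<^bsub>K\<^esub>
     else if w \<in> capelli_word ws ` {\<pi>. \<pi> permutes set ws \<and> \<not> evenperm \<pi>} then \<ominus>\<^bsub>K\<^esub> \<one>\<^bsub>K\<^esub>
     else \<zero>\<^bsub>K\<^esub>)"

lemma zero_QuotAlg: "\<zero>\<^bsub>A QuotAlg I\<^esub> = I"
  by (simp add: quotient_algebra_def ring.defs module.defs FactRing_def)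

section \<open>Distinctness of the monomials\<close>

lemma map_Suc_append_0_cancel:
  "map Suc u @ 0 # r = map Suc v @ 0 # s \<longleftrightarrow> u = v \<and> r = s"
proof (induction u arbitrary: v)
  case Nil
  then show ?case by (cases v) auto
next
  case (Cons a u)
  then show ?case by (cases v) auto
qed

text \<open>The letter 0 does not occur in \<open>map Suc u\<close>, so the first 0 marks where the
  first block ends. The blocks can therefore be read off one after another.\<close>

lemma capelli_word_eqD: "capelli_word ws \<pi> = capelli_word ws \<rho> \<Longrightarrow> map \<pi> ws = map \<rho> ws"
  by (induction ws) (auto simp: capelli_word_def map_Suc_append_0_cancel)

text \<open>The word determines the permutation on \<open>set ws\<close>, and outside this set every
  permutation considered is the identity.\<close>

lemma inj_on_capelli_word: "inj_on (capelli_word ws) {\<pi>. \<pi> permutes set ws}"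
proof (rule inj_onI, rule ext)
  fix \<pi> \<rho> v
  assume "\<pi> \<in> {\<pi>. \<pi> permutes set ws}" "\<rho> \<in> {\<pi>. \<pi> permutes set ws}"
    and "capelli_word ws \<pi> = capelli_word ws \<rho>"
  then show "\<pi> v = \<rho> v"
    by (cases "v \<in> set ws") (auto dest: capelli_word_eqD simp: permutes_not_in)
qed

section \<open>Evaluation in a ring and vanishing at repeated arguments\<close>

context ring
begin

lemma separated_prod_closed [simp]:
  "\<lbrakk>y \<in> carrier R; set vs \<subseteq> carrier R\<rbrakk> \<Longrightarrow> separated_prod R y vs \<in> carrier R"
  by (induction vs) (auto simp: separated_prod_def)

lemma word_eval_closed [simp]: "x \<in> UNIV \<rightarrow> carrier R \<Longrightarrow> word_eval R x w \<in> carrier R"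
  by (induction w) (auto simp: word_eval_def Pi_iff)

lemma word_eval_append:
  "x \<in> UNIV \<rightarrow> carrier R \<Longrightarrow> word_eval R x (u @ v) = word_eval R x u \<otimes> word_eval R x v"
proof (induction u)
  case Nil
  then show ?case using word_eval_closed[of x v] by (simp add: word_eval_def)
next
  case (Cons i u)
  then show ?case
    using word_eval_closed[of x u] word_eval_closed[of x v]
    by (simp add: word_eval_def Pi_iff m_assoc)
qed

text \<open>Links the monomials to the separated products: \<open>x 0\<close> becomes the separator,
  and \<open>x \<circ> Suc\<close> undoes the shift of the other variables.\<close>

lemma word_eval_capelli_word:
  assumes x: "x \<in> UNIV \<rightarrow> carrier R"
  shows "word_eval R x (capelli_word ws \<pi>)
    = separated_prod R (x 0) (map (word_eval R (x \<circ> Suc) \<circ> \<pi>) ws)"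
proof (induction ws)
  case Nil
  then show ?case by (simp add: capelli_word_def separated_prod_def word_eval_def)
next
  case (Cons w ws)
  have "word_eval R x (capelli_word (w # ws) \<pi>)
      = word_eval R x (map Suc (\<pi> w)) \<otimes> word_eval R x (0 # capelli_word ws \<pi>)"
    by (simp add: capelli_word_def word_eval_append[OF x])
  also have "word_eval R x (map Suc (\<pi> w)) = word_eval R (x \<circ> Suc) (\<pi> w)"
    by (simp add: word_eval_def foldr_map comp_def)
  also have "word_eval R x (0 # capelli_word ws \<pi>) = x 0 \<otimes> word_eval R x (capelli_word ws \<pi>)"
    by (simp add: word_eval_def)
  finally show ?case by (simp add: Cons.IH separated_prod_def)
qed

lemma separated_prod_append:
  assumes "y \<in> carrier R" "set us \<subseteq> carrier R" "set vs \<subseteq> carrier R"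
  shows "separated_prod R y (us @ vs) = separated_prod R y us \<otimes> separated_prod R y vs"
  using assms(2)
proof (induction us)
  case Nil
  then show ?case using separated_prod_closed[OF assms(1,3)] by (simp add: separated_prod_def)
next
  case (Cons u us)
  then show ?case
    using separated_prod_closed[OF assms(1,3)] separated_prod_closed[OF assms(1), of us] assms(1)
    by (simp add: separated_prod_def m_assoc)
qed

text \<open>Since \<open>is\<close> is distinct, \<open>j\<close> occurs in it exactly once.
  Splitting the product there leaves a left and a right factor that do not depend on the value put
  into the slot, which is the source of linearity.\<close>

lemma separated_prod_one_slot:
  assumes y: "y \<in> carrier R" and z: "z \<in> UNIV \<rightarrow> carrier R" and "distinct is" "j \<in> set is"
  obtains a b where "a \<in> carrier R" "b \<in> carrier R"
    "\<And>v. v \<in> carrier R \<Longrightarrow> separated_prod R y (map (z(j := v)) is) = a \<otimes> v \<otimes> b"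
proof -
  have zA: "z i \<in> carrier R" for i using z by auto
  obtain p q where pq: "is = p @ j # q" using assms(4) split_list by metis
  with assms(3) have j: "j \<notin> set p" "j \<notin> set q" by auto
  let ?a = "separated_prod R y (map z p)" and ?b = "y \<otimes> separated_prod R y (map z q)"
  have car: "?a \<in> carrier R" "?b \<in> carrier R"
    using y by (simp_all add: image_subset_iff zA)
  have "separated_prod R y (map (z(j := v)) is) = ?a \<otimes> v \<otimes> ?b" if v: "v \<in> carrier R" for v
  proof -
    have "map (z(j := v)) is = map z p @ v # map z q"
      using j by (auto simp: pq)
    then have "separated_prod R y (map (z(j := v)) is) = ?a \<otimes> separated_prod R y (v # map z q)"
      using y v by (simp add: separated_prod_append image_subset_iff zA)
    also have "separated_prod R y (v # map z q) = v \<otimes> ?b"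
      by (simp add: separated_prod_def)
    finally show ?thesis using car v by (simp only: m_assoc)
  qed
  with car show ?thesis by (rule that)
qed

lemma capelli_closed:
  assumes "y \<in> carrier R" "z \<in> UNIV \<rightarrow> carrier R"
  shows "capelli R y z is \<in> carrier R"
proof -
  have "separated_prod R y (map (z \<circ> \<pi>) is) \<in> carrier R" for \<pi>
    using assms by (intro separated_prod_closed) auto
  then show ?thesis unfolding capelli_def by (intro minus_closed finsum_closed) auto
qed

lemma capelli_word_eval_closed:
  assumes "x \<in> UNIV \<rightarrow> carrier R"
  shows "capelli R (x 0) (word_eval R (x \<circ> Suc)) ws \<in> carrier R"
proof (rule capelli_closed)
  have "x \<circ> Suc \<in> UNIV \<rightarrow> carrier R" using assms by auto
  then show "word_eval R (x \<circ> Suc) \<in> UNIV \<rightarrow> carrier R" using word_eval_closed by blast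
qed (use assms in auto)

text \<open>Composition with the transposition of \<open>i\<close> and \<open>j\<close> maps the
  even permutations bijectively onto the odd ones. It leaves every summand unchanged because
  \<open>z i = z j\<close>, so the two sums coincide.\<close>

lemma capelli_eq_zero_of_eq:
  fixes z :: "'i \<Rightarrow> 'a"
  assumes y: "y \<in> carrier R" and z: "z \<in> UNIV \<rightarrow> carrier R"
    and ij: "i \<in> set is" "j \<in> set is" "i \<noteq> j" "z i = z j"
  shows "capelli R y z is = \<zero>"
proof -
  let ?t = "\<lambda>\<pi> :: 'i \<Rightarrow> 'i. transpose i j \<circ> \<pi>" and ?P = "\<lambda>\<pi>. separated_prod R y (map (z \<circ> \<pi>) is)"
  let ?E = "{\<pi>. \<pi> permutes set is \<and> evenperm \<pi>}"
  let ?O = "{\<pi>. \<pi> permutes set is \<and> \<not> evenperm \<pi>}"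
  have tt: "?t (?t \<pi>) = \<pi>" for \<pi>
    by (simp add: fun_eq_iff)
  have t: "?t \<pi> permutes set is \<and> (evenperm (?t \<pi>) \<longleftrightarrow> \<not> evenperm \<pi>)"
    if "\<pi> permutes set is" for \<pi>
  proof -
    have "permutation \<pi>" using that permutation_permutes by blast
    then show ?thesis using that ij
      by (simp add: permutes_compose permutes_swap_id evenperm_comp permutation_swap_id evenperm_swap)
  qed
  have O: "?O = ?t ` ?E"
  proof
    show "?O \<subseteq> ?t ` ?E"
    proof
      fix \<pi> assume "\<pi> \<in> ?O"
      then have "?t \<pi> \<in> ?E" using t[of \<pi>] by blast
      then show "\<pi> \<in> ?t ` ?E" by (rule rev_image_eqI) (rule tt[symmetric])
    qed
  qed (use t in blast)
  \<comment> \<open>The transposition acts next to \<open>z\<close>, before \<open>\<pi>\<close> is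
    undone, so it is absorbed by \<open>z\<close> whatever \<open>\<pi>\<close> is.\<close>
  have "z \<circ> transpose i j = z"
    using ij(4) by (auto simp: fun_eq_iff transpose_def)
  then have Pt: "?P (?t \<pi>) = ?P \<pi>" for \<pi>
    by (simp only: comp_assoc[symmetric])
  have inj: "inj_on ?t ?E" by (rule inj_on_inverseI[of _ ?t]) (rule tt)
  have P: "?P \<pi> \<in> carrier R" for \<pi>
    using y z by (intro separated_prod_closed) auto
  have "finsum R ?P ?O = finsum R (\<lambda>\<pi>. ?P (?t \<pi>)) ?E"
    unfolding O by (rule finsum_reindex) (use P inj in auto)
  then have "finsum R ?P ?O = finsum R ?P ?E" unfolding Pt .
  moreover have "finsum R ?P ?E \<in> carrier R" using P by (intro finsum_closed) auto
  ultimately show ?thesis by (simp add: capelli_def r_neg a_minus_def)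
qed

end

text \<open>The expression is built from ring operations alone, so homomorphisms commute with it.
  This is applied to the projection onto a quotient.\<close>

lemma (in ring_hom_ring) hom_capelli_word_eval:
  assumes x: "x \<in> UNIV \<rightarrow> carrier R"
  shows "h (capelli R (x 0) (word_eval R (x \<circ> Suc)) ws)
    = capelli S (h (x 0)) (word_eval S (h \<circ> x \<circ> Suc)) ws"
proof -
  have w: "h (word_eval R x' w) = word_eval S (h \<circ> x') w" if "x' \<in> UNIV \<rightarrow> carrier R" for x' w
  proof (induction w)
    case (Cons i w)
    then show ?case using that R.word_eval_closed[OF that, of w]
      by (simp add: word_eval_def Pi_iff)
  qed (simp add: word_eval_def)
  have sp: "h (separated_prod R y vs) = separated_prod S (h y) (map h vs)"
    if "y \<in> carrier R" "set vs \<subseteq> carrier R" for y vs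
    using that(2)
  proof (induction vs)
    case (Cons v vs)
    then show ?case using that(1) R.separated_prod_closed[OF that(1), of vs]
      by (simp add: separated_prod_def)
  qed (simp add: separated_prod_def)
  have x': "x \<circ> Suc \<in> UNIV \<rightarrow> carrier R" using x by auto
  have P: "separated_prod R (x 0) (map (word_eval R (x \<circ> Suc) \<circ> \<pi>) ws) \<in> carrier R" for \<pi>
    using x by (intro R.separated_prod_closed) (auto simp: R.word_eval_closed[OF x'])
  have "h (separated_prod R (x 0) (map (word_eval R (x \<circ> Suc) \<circ> \<pi>) ws))
      = separated_prod S (h (x 0)) (map (word_eval S (h \<circ> x \<circ> Suc) \<circ> \<pi>) ws)" for \<pi>
  proof -
    have "set (map (word_eval R (x \<circ> Suc) \<circ> \<pi>) ws) \<subseteq> carrier R" "x 0 \<in> carrier R"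
      using x R.word_eval_closed[OF x'] by auto
    moreover have "map h (map (word_eval R (x \<circ> Suc) \<circ> \<pi>) ws)
        = map (word_eval S (h \<circ> x \<circ> Suc) \<circ> \<pi>) ws"
      by (rule nth_equalityI) (simp_all add: w[OF x', unfolded comp_assoc[symmetric]])
    ultimately show ?thesis by (simp only: sp)
  qed
  then show ?thesis
    using P by (simp add: capelli_def a_minus_def hom_finsum Pi_iff o_def)
qed

section \<open>Multilinearity and vanishing on linearly dependent values\<close>

context assoc_algebra
begin

text \<open>For each permutation the summand has the form
  \<open>a \<pi> \<otimes> v \<otimes> b \<pi>\<close>, which is linear in \<open>v\<close>.
  Linearity then passes to the even and the odd sum and to their difference.\<close>

lemma capelli_linear_in_slot:
  assumes y: "y \<in> carrier A" and z: "z \<in> UNIV \<rightarrow> carrier A" and "distinct is" "j \<in> set is"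
  shows capelli_slot_add: "\<lbrakk>u \<in> carrier A; v \<in> carrier A\<rbrakk> \<Longrightarrow> capelli A y (z(j := u \<oplus>\<^bsub>A\<^esub> v)) is
      = capelli A y (z(j := u)) is \<oplus>\<^bsub>A\<^esub> capelli A y (z(j := v)) is"
    and capelli_slot_smult: "\<lbrakk>c \<in> carrier K; v \<in> carrier A\<rbrakk> \<Longrightarrow>
      capelli A y (z(j := c \<odot>\<^bsub>A\<^esub> v)) is = c \<odot>\<^bsub>A\<^esub> capelli A y (z(j := v)) is"
proof -
  let ?P = "\<lambda>v \<pi>. separated_prod A y (map (z(j := v) \<circ> \<pi>) is)"
  let ?Q = "{\<pi>. \<pi> permutes set is}"
  have "\<forall>\<pi>. \<exists>a b. \<pi> \<in> ?Q \<longrightarrow> a \<in> carrier A \<and> b \<in> carrier A \<and>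
      (\<forall>v \<in> carrier A. ?P v \<pi> = a \<otimes>\<^bsub>A\<^esub> v \<otimes>\<^bsub>A\<^esub> b)"
  proof (intro allI)
    fix \<pi>
    show "\<exists>a b. \<pi> \<in> ?Q \<longrightarrow> a \<in> carrier A \<and> b \<in> carrier A \<and>
      (\<forall>v \<in> carrier A. ?P v \<pi> = a \<otimes>\<^bsub>A\<^esub> v \<otimes>\<^bsub>A\<^esub> b)"
    proof (cases "\<pi> \<in> ?Q")
      case True
      \<comment> \<open>Reading \<open>z \<circ> \<pi>\<close> along \<open>is\<close> is the same
        as reading \<open>z\<close> along \<open>map \<pi> is\<close>. This rearranged list again
        contains \<open>j\<close> exactly once, so the one-slot lemma applies to it.\<close>
      then have "distinct (map \<pi> is)" "j \<in> set (map \<pi> is)"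
        using assms(3,4) by (auto simp: distinct_map permutes_inj_on permutes_image)
      from separated_prod_one_slot[OF y z this] show ?thesis
        by (metis map_map)
    qed simp
  qed
  then obtain a b where ab: "\<And>\<pi>. \<pi> \<in> ?Q \<Longrightarrow> a \<pi> \<in> carrier A" "\<And>\<pi>. \<pi> \<in> ?Q \<Longrightarrow> b \<pi> \<in> carrier A"
    "\<And>\<pi> v. \<lbrakk>\<pi> \<in> ?Q; v \<in> carrier A\<rbrakk> \<Longrightarrow> ?P v \<pi> = a \<pi> \<otimes>\<^bsub>A\<^esub> v \<otimes>\<^bsub>A\<^esub> b \<pi>"
    by metis
  let ?S = "\<lambda>B v. \<Oplus>\<^bsub>A\<^esub>\<pi>\<in>B. a \<pi> \<otimes>\<^bsub>A\<^esub> v \<otimes>\<^bsub>A\<^esub> b \<pi>"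
  have cap: "capelli A y (z(j := v)) is =
      ?S {\<pi>. \<pi> permutes set is \<and> evenperm \<pi>} v \<ominus>\<^bsub>A\<^esub> ?S {\<pi>. \<pi> permutes set is \<and> \<not> evenperm \<pi>} v"
    if "v \<in> carrier A" for v
    unfolding capelli_def
    by (intro arg_cong2[where f = "\<lambda>u v. u \<ominus>\<^bsub>A\<^esub> v"] finsum_cong') (use ab that in auto)
  have S: "?S B v \<in> carrier A" if "B \<subseteq> ?Q" "v \<in> carrier A" for B v
    using that ab by (intro finsum_closed) auto
  have add: "?S B (u \<oplus>\<^bsub>A\<^esub> v) = ?S B u \<oplus>\<^bsub>A\<^esub> ?S B v"
    if "B \<subseteq> ?Q" "u \<in> carrier A" "v \<in> carrier A" for B u v
  proof -
    have "?S B (u \<oplus>\<^bsub>A\<^esub> v)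
        = (\<Oplus>\<^bsub>A\<^esub>\<pi>\<in>B. a \<pi> \<otimes>\<^bsub>A\<^esub> u \<otimes>\<^bsub>A\<^esub> b \<pi> \<oplus>\<^bsub>A\<^esub> a \<pi> \<otimes>\<^bsub>A\<^esub> v \<otimes>\<^bsub>A\<^esub> b \<pi>)"
      using that ab by (intro finsum_cong') (auto simp: subset_iff r_distr l_distr)
    also have "\<dots> = ?S B u \<oplus>\<^bsub>A\<^esub> ?S B v"
      using that ab by (intro finsum_addf) (auto simp: subset_iff)
    finally show ?thesis .
  qed
  have smult: "?S B (c \<odot>\<^bsub>A\<^esub> v) = c \<odot>\<^bsub>A\<^esub> ?S B v"
    if "B \<subseteq> ?Q" "c \<in> carrier K" "v \<in> carrier A" for B c v
  proof -
    have "finite B" using that(1) finite_permutations[of "set is"] finite_subset by auto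
    then have "c \<odot>\<^bsub>A\<^esub> ?S B v = (\<Oplus>\<^bsub>A\<^esub>\<pi>\<in>B. c \<odot>\<^bsub>A\<^esub> (a \<pi> \<otimes>\<^bsub>A\<^esub> v \<otimes>\<^bsub>A\<^esub> b \<pi>))"
      using that ab by (intro finsum_smult_ldistr) (auto simp: subset_iff)
    also have "\<dots> = ?S B (c \<odot>\<^bsub>A\<^esub> v)"
      using that ab by (intro finsum_cong') (auto simp: subset_iff smult_mult_left smult_mult_right)
    finally show ?thesis by simp
  qed
  have sub: "{\<pi>. \<pi> permutes set is \<and> Q \<pi>} \<subseteq> ?Q" for Q by auto
  show "\<lbrakk>u \<in> carrier A; v \<in> carrier A\<rbrakk> \<Longrightarrow> capelli A y (z(j := u \<oplus>\<^bsub>A\<^esub> v)) is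
      = capelli A y (z(j := u)) is \<oplus>\<^bsub>A\<^esub> capelli A y (z(j := v)) is"
    using S[OF sub] by (simp add: cap add[OF sub] a_minus_def minus_add a_ac)
  show "capelli A y (z(j := c \<odot>\<^bsub>A\<^esub> v)) is = c \<odot>\<^bsub>A\<^esub> capelli A y (z(j := v)) is"
    if "c \<in> carrier K" "v \<in> carrier A"
    using that S[OF sub] by (simp add: cap smult[OF sub] a_minus_def smult_r_distr smult_r_minus)
qed

text \<open>Putting the vanishing linear combination into slot \<open>j\<close> gives 0. Expanding
  by linearity instead, every term with \<open>i \<noteq> j\<close> has a repeated argument and
  drops out, which leaves \<open>c j\<close> times the original value. As \<open>c j\<close> is
  invertible, that value is 0.\<close>

lemma capelli_eq_zero_of_dependent:
  assumes y: "y \<in> carrier A" and z: "z \<in> UNIV \<rightarrow> carrier A" and "distinct is" "j \<in> set is"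
    and c: "c \<in> UNIV \<rightarrow> carrier K" "c j \<noteq> \<zero>"
    and dep: "(\<Oplus>\<^bsub>A\<^esub>i\<in>set is. c i \<odot>\<^bsub>A\<^esub> z i) = \<zero>\<^bsub>A\<^esub>"
  shows "capelli A y z is = \<zero>\<^bsub>A\<^esub>"
proof -
  define D where "D v = capelli A y (z(j := v)) is" for v
  have D_closed: "D v \<in> carrier A" if "v \<in> carrier A" for v
    unfolding D_def using y z that by (intro capelli_closed) auto
  have D_add: "D (u \<oplus>\<^bsub>A\<^esub> v) = D u \<oplus>\<^bsub>A\<^esub> D v" if "u \<in> carrier A" "v \<in> carrier A" for u v
    unfolding D_def using that by (rule capelli_slot_add[OF assms(1-4)])
  have D_smult: "D (a \<odot>\<^bsub>A\<^esub> v) = a \<odot>\<^bsub>A\<^esub> D v" if "a \<in> carrier K" "v \<in> carrier A" for a v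
    unfolding D_def using that by (rule capelli_slot_smult[OF assms(1-4)])
  have cK: "c i \<in> carrier K" and zA: "z i \<in> carrier A" for i using c z by auto
  have D0: "D \<zero>\<^bsub>A\<^esub> = \<zero>\<^bsub>A\<^esub>"
    using D_smult[of \<zero> "\<zero>\<^bsub>A\<^esub>"] D_closed[of "\<zero>\<^bsub>A\<^esub>"] by simp
  have D_sum: "D (\<Oplus>\<^bsub>A\<^esub>i\<in>J. c i \<odot>\<^bsub>A\<^esub> z i) = (\<Oplus>\<^bsub>A\<^esub>i\<in>J. c i \<odot>\<^bsub>A\<^esub> D (z i))" if "finite J" for J
    using that
  proof induction
    case (insert i J)
    then show ?case
      by (simp add: cK zA D_closed D_add D_smult Pi_iff finsum_closed)
  qed (simp add: D0)
  \<comment> \<open>The function \<open>z(j := z i)\<close> takes the same value at the distinct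
    indices \<open>i\<close> and \<open>j\<close>.\<close>
  have Dz: "D (z i) = \<zero>\<^bsub>A\<^esub>" if "i \<in> set is" "i \<noteq> j" for i
    unfolding D_def using that assms(4)
    by (intro capelli_eq_zero_of_eq[OF y, of _ i _ j]) (simp_all add: zA)
  have "\<zero>\<^bsub>A\<^esub> = (\<Oplus>\<^bsub>A\<^esub>i\<in>set is. c i \<odot>\<^bsub>A\<^esub> D (z i))"
    using D_sum[of "set is"] dep D0 by simp
  also have "\<dots> = (\<Oplus>\<^bsub>A\<^esub>i\<in>insert j (set is - {j}). c i \<odot>\<^bsub>A\<^esub> D (z i))"
    using assms(4) by (simp add: insert_absorb)
  also have "\<dots> = c j \<odot>\<^bsub>A\<^esub> D (z j) \<oplus>\<^bsub>A\<^esub> (\<Oplus>\<^bsub>A\<^esub>i\<in>set is - {j}. c i \<odot>\<^bsub>A\<^esub> D (z i))"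
    by (rule finsum_insert) (simp_all add: cK zA D_closed)
  also have "(\<Oplus>\<^bsub>A\<^esub>i\<in>set is - {j}. c i \<odot>\<^bsub>A\<^esub> D (z i)) = (\<Oplus>\<^bsub>A\<^esub>i\<in>set is - {j}. \<zero>\<^bsub>A\<^esub>)"
    by (rule finsum_cong') (simp_all add: Dz cK)
  finally have 0: "c j \<odot>\<^bsub>A\<^esub> D (z j) = \<zero>\<^bsub>A\<^esub>"
    using D_closed[OF zA, of j] cK[of j] by simp
  have inv: "inv c j \<in> carrier K" "inv c j \<otimes> c j = \<one>"
    using c cK[of j] by (simp_all add: field_Units)
  then have "D (z j) = inv c j \<odot>\<^bsub>A\<^esub> (c j \<odot>\<^bsub>A\<^esub> D (z j))"
    using D_closed[OF zA, of j] cK[of j] by (simp add: smult_assoc1[symmetric])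
  also have "\<dots> = \<zero>\<^bsub>A\<^esub>" using 0 inv by simp
  \<comment> \<open>Putting \<open>z j\<close> into slot \<open>j\<close> changes nothing, so
    \<open>D (z j)\<close> is the original expression.\<close>
  finally show ?thesis by (simp add: D_def)
qed

text \<open>The words of the support serve as indices and their values as arguments. Evaluated at
  the shifted substitution \<open>x \<circ> Suc\<close>, the identity is a linear relation between
  these values with coefficients \<open>f\<close>, all nonzero on \<open>set ws\<close>.\<close>

lemma capelli_word_eval_eq_zero:
  assumes "polynomial_identity K A f" and ws: "distinct ws" "set ws = {w. f w \<noteq> \<zero>}" "ws \<noteq> []"
    and x: "x \<in> UNIV \<rightarrow> carrier A"
  shows "capelli A (x 0) (word_eval A (x \<circ> Suc)) ws = \<zero>\<^bsub>A\<^esub>"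
proof -
  from ws(3) obtain j where j: "j \<in> set ws" by (cases ws) auto
  have x': "x \<circ> Suc \<in> UNIV \<rightarrow> carrier A" using x by auto
  have f: "f \<in> UNIV \<rightarrow> carrier K" "nc_eval K A f (x \<circ> Suc) = \<zero>\<^bsub>A\<^esub>"
    using assms(1) x' by (auto simp: polynomial_identity_def nc_polys_def)
  show ?thesis
  proof (rule capelli_eq_zero_of_dependent[where c = f and j = j])
    show "x 0 \<in> carrier A" using x by auto
    show "word_eval A (x \<circ> Suc) \<in> UNIV \<rightarrow> carrier A" using word_eval_closed[OF x'] by blast
    show "f j \<noteq> \<zero>" using j ws(2) by simp
    show "(\<Oplus>\<^bsub>A\<^esub>i\<in>set ws. f i \<odot>\<^bsub>A\<^esub> word_eval A (x \<circ> Suc) i) = \<zero>\<^bsub>A\<^esub>"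
      using f(2) unfolding nc_eval_def ws(2) .
  qed (fact ws(1) j f(1))+
qed

section \<open>The alternating sum as a nonzero noncommutative polynomial\<close>

lemma capelli_poly_nc_poly: "capelli_poly K ws \<in> nc_polys K"
proof -
  have "{w. capelli_poly K ws w \<noteq> \<zero>} \<subseteq> capelli_word ws ` {\<pi>. \<pi> permutes set ws}"
    by (auto simp: capelli_poly_def split: if_splits)
  then have "finite {w. capelli_poly K ws w \<noteq> \<zero>}"
    by (rule finite_subset) (simp add: finite_permutations)
  moreover have "capelli_poly K ws w \<in> carrier K" for w by (simp add: capelli_poly_def)
  ultimately show ?thesis by (simp add: nc_polys_def)
qed

lemma capelli_poly_nonzero: "capelli_poly K ws \<noteq> (\<lambda>w. \<zero>)"
proof -
  \<comment> \<open>The monomial of the identity permutation, which is even, witnesses a nonzero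
    coefficient.\<close>
  have "id \<in> {\<pi>. \<pi> permutes set ws \<and> evenperm \<pi>}" by (simp add: permutes_id)
  then have "capelli_poly K ws (capelli_word ws id) = \<one>"
    unfolding capelli_poly_def by (simp only: imageI if_True)
  then show ?thesis using scalars.one_not_zero by metis
qed

text \<open>The support is the disjoint union of the words of the even and of the odd permutations.
  Injectivity of \<open>capelli_word ws\<close> turns the sums over words into sums over
  permutations.\<close>

lemma nc_eval_capelli_poly:
  assumes x: "x \<in> UNIV \<rightarrow> carrier A"
  shows "nc_eval K A (capelli_poly K ws) x = capelli A (x 0) (word_eval A (x \<circ> Suc)) ws"
proof -
  let ?E = "{\<pi>. \<pi> permutes set ws \<and> evenperm \<pi>}"
  let ?O = "{\<pi>. \<pi> permutes set ws \<and> \<not> evenperm \<pi>}"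
  let ?e = "capelli_word ws" and ?f = "capelli_poly K ws"
  let ?g = "\<lambda>w. ?f w \<odot>\<^bsub>A\<^esub> word_eval A x w"
  have fin: "finite (?e ` ?E)" "finite (?e ` ?O)"
    by (auto simp: finite_permutations)
  have disj: "?e ` ?E \<inter> ?e ` ?O = {}"
    using inj_on_capelli_word[of ws] by (auto simp: inj_on_def)
  have inj: "inj_on ?e ?E" "inj_on ?e ?O"
    by (rule inj_on_subset[OF inj_on_capelli_word], auto)+
  have supp: "{w. ?f w \<noteq> \<zero>} = ?e ` ?E \<union> ?e ` ?O"
    using one_not_zero by (auto simp: capelli_poly_def)
  have fE: "?f w = \<one>" if "w \<in> ?e ` ?E" for w using that by (auto simp: capelli_poly_def)
  \<comment> \<open>Disjointness rules out the first case of \<open>capelli_poly\<close>, which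
    would give the coefficient 1.\<close>
  have fO: "?f w = \<ominus> \<one>" if "w \<in> ?e ` ?O" for w
    using that disj by (auto simp: capelli_poly_def)
  have g: "?g \<in> B \<rightarrow> carrier A" for B
    using x capelli_poly_nc_poly[of ws] by (auto simp: nc_polys_def)
  have E: "finsum A ?g (?e ` ?E) = finsum A (\<lambda>\<pi>. word_eval A x (?e \<pi>)) ?E"
    unfolding finsum_reindex[OF g inj(1)]
    by (rule finsum_cong') (use x fE in auto)
  have "finsum A ?g (?e ` ?O) = finsum A (\<lambda>\<pi>. (\<ominus> \<one>) \<odot>\<^bsub>A\<^esub> word_eval A x (?e \<pi>)) ?O"
    unfolding finsum_reindex[OF g inj(2)]
    by (rule finsum_cong') (use x fO in auto)
  also have "\<dots> = (\<ominus> \<one>) \<odot>\<^bsub>A\<^esub> finsum A (\<lambda>\<pi>. word_eval A x (?e \<pi>)) ?O"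
    using x by (intro finsum_smult_ldistr[symmetric]) (auto simp: finite_permutations)
  also have "\<dots> = \<ominus>\<^bsub>A\<^esub> finsum A (\<lambda>\<pi>. word_eval A x (?e \<pi>)) ?O"
    using x by (simp add: smult_l_minus finsum_closed Pi_iff)
  finally have O: "finsum A ?g (?e ` ?O) = \<ominus>\<^bsub>A\<^esub> finsum A (\<lambda>\<pi>. word_eval A x (?e \<pi>)) ?O" .
  have "nc_eval K A ?f x = finsum A ?g (?e ` ?E) \<oplus>\<^bsub>A\<^esub> finsum A ?g (?e ` ?O)"
    unfolding nc_eval_def supp by (rule finsum_Un_disjoint[OF fin disj g g])
  then show ?thesis
    unfolding E O capelli_def a_minus_def word_eval_capelli_word[OF x] .
qed

section \<open>Passage to quotients and values in ideals\<close>

lemma ring_hom_ring_QuotAlg: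
  assumes "ideal I A"
  shows "ring_hom_ring A (A QuotAlg I) (\<lambda>x. I +>\<^bsub>A\<^esub> x)"
proof -
  interpret I: ideal I A by fact
  interpret Q: assoc_algebra K "A QuotAlg I" by (rule assoc_algebra_quotient[OF assms])
  have "(\<lambda>x. I +>\<^bsub>A\<^esub> x) \<in> ring_hom A (A Quot I)" by (rule I.rcos_ring_hom)
  then have "(\<lambda>x. I +>\<^bsub>A\<^esub> x) \<in> ring_hom A (A QuotAlg I)"
    by (simp add: ring_hom_def quotient_algebra_def ring.defs module.defs)
  then show ?thesis by (intro ring_hom_ring.intro ring_hom_ring_axioms.intro ring_axioms Q.ring_axioms)
qed

text \<open>Take for \<open>ws\<close> the support of an identity of the quotient. The projection
  sends each value of the alternating sum to the corresponding value in the quotient, which is 0.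
  The list is chosen before \<open>x\<close>, so one \<open>ws\<close> serves all
  substitutions.\<close>

lemma capelli_mem_ideal_of_PI_quotient:
  assumes "ideal I A" "PI_algebra K (A QuotAlg I)"
  shows "\<exists>ws. \<forall>x \<in> UNIV \<rightarrow> carrier A. capelli A (x 0) (word_eval A (x \<circ> Suc)) ws \<in> I"
proof -
  interpret I: ideal I A by fact
  interpret Q: assoc_algebra K "A QuotAlg I" by (rule assoc_algebra_quotient[OF assms(1)])
  interpret h: ring_hom_ring A "A QuotAlg I" "\<lambda>x. I +>\<^bsub>A\<^esub> x"
    by (rule ring_hom_ring_QuotAlg[OF assms(1)])
  from assms(2) obtain f where f: "f \<noteq> (\<lambda>w. \<zero>)" "polynomial_identity K (A QuotAlg I) f"
    unfolding PI_algebra_def by blast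
  then have "finite {w. f w \<noteq> \<zero>}" by (simp add: polynomial_identity_def nc_polys_def)
  then obtain ws where ws: "set ws = {w. f w \<noteq> \<zero>}" "distinct ws"
    using finite_distinct_list by blast
  obtain w where "f w \<noteq> \<zero>" using f(1) by blast
  with ws(1) have "ws \<noteq> []" by force
  have "capelli A (x 0) (word_eval A (x \<circ> Suc)) ws \<in> I" if x: "x \<in> UNIV \<rightarrow> carrier A" for x
  proof -
    let ?c = "capelli A (x 0) (word_eval A (x \<circ> Suc)) ws"
    have c: "?c \<in> carrier A" using x by (rule capelli_word_eval_closed)
    have "(\<lambda>x. I +>\<^bsub>A\<^esub> x) \<circ> x \<in> UNIV \<rightarrow> carrier (A QuotAlg I)"
    proof
      fix i
      have "x i \<in> carrier A" using x by blast
      then show "((\<lambda>x. I +>\<^bsub>A\<^esub> x) \<circ> x) i \<in> carrier (A QuotAlg I)"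
        unfolding o_apply by (rule h.hom_closed)
    qed
    from Q.capelli_word_eval_eq_zero[OF f(2) ws(2,1) \<open>ws \<noteq> []\<close> this]
    have "I +>\<^bsub>A\<^esub> ?c = \<zero>\<^bsub>A QuotAlg I\<^esub>"
      unfolding h.hom_capelli_word_eval[OF x] by (simp only: o_apply)
    also have "\<dots> = I" by (rule zero_QuotAlg)
    \<comment> \<open>The value lies in its own coset, and this coset is \<open>I\<close>.\<close>
    finally show ?thesis by (rule equalityD1[THEN subsetD, OF _ I.a_rcos_self[OF c]])
  qed
  then show ?thesis by blast
qed

text \<open>Otherwise \<open>capelli_poly K ws\<close> would be a nontrivial identity. The list
  \<open>ws\<close> is arbitrary, possibly empty or with repetitions, so the ideals of the theorem
  can be indexed by all lists of words.\<close>

lemma capelli_nonzero_of_not_PI: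
  assumes "\<not> PI_algebra K A"
  obtains x where "x \<in> UNIV \<rightarrow> carrier A" "capelli A (x 0) (word_eval A (x \<circ> Suc)) ws \<noteq> \<zero>\<^bsub>A\<^esub>"
proof -
  have "\<not> polynomial_identity K A (capelli_poly K ws)"
    using assms assoc_algebra_axioms capelli_poly_nonzero[of ws] unfolding PI_algebra_def by blast
  then obtain x where x: "x \<in> UNIV \<rightarrow> carrier A" "nc_eval K A (capelli_poly K ws) x \<noteq> \<zero>\<^bsub>A\<^esub>"
    unfolding polynomial_identity_def using capelli_poly_nc_poly by blast
  from x(2) have "capelli A (x 0) (word_eval A (x \<circ> Suc)) ws \<noteq> \<zero>\<^bsub>A\<^esub>"
    unfolding nc_eval_capelli_poly[OF x(1)] .
  with x(1) show ?thesis by (rule that)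
qed

end

section \<open>Countable cofinal collections and separating sets\<close>

lemma separating_set_of_cofinal_ideals:
  assumes "ring R" and \<C>: "countable_cofinal_ideals R \<C>"
  shows "\<exists>S. countable S \<and> separating_set R S"
proof -
  have "\<exists>s. s \<in> I \<and> s \<in> carrier R \<and> s \<noteq> \<zero>\<^bsub>R\<^esub>" if "I \<in> \<C>" for I
  proof -
    from that \<C> have "ideal I R" "I \<noteq> {\<zero>\<^bsub>R\<^esub>}"
      by (auto simp: countable_cofinal_ideals_def nonzero_ideals_def)
    then interpret ideal I R by simp
    have "\<zero>\<^bsub>R\<^esub> \<in> I" "I \<subseteq> carrier R" by simp (rule a_subset)
    with \<open>I \<noteq> {\<zero>\<^bsub>R\<^esub>}\<close> show ?thesis by blast
  qed
  \<comment> \<open>One nonzero element is chosen from each ideal of the collection. A nonzero ideal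
    contains some member of the collection and hence the element chosen from it.\<close>
  then obtain s where s: "\<And>I. I \<in> \<C> \<Longrightarrow> s I \<in> I \<and> s I \<in> carrier R \<and> s I \<noteq> \<zero>\<^bsub>R\<^esub>"
    by metis
  have "separating_set R (s ` \<C>)"
    unfolding separating_set_def
  proof (intro conjI ballI)
    fix J assume "J \<in> nonzero_ideals R"
    with \<C> obtain I where "I \<in> \<C>" "I \<subseteq> J"
      unfolding countable_cofinal_ideals_def by blast
    then have "s I \<in> J \<inter> s ` \<C>" using s[of I] by blast
    then show "J \<inter> s ` \<C> \<noteq> {}" by blast
  next
    show "s ` \<C> \<subseteq> carrier R" using s by blast
    show "\<zero>\<^bsub>R\<^esub> \<notin> s ` \<C>" using s by (metis imageE)
  qed
  moreover have "countable (s ` \<C>)" using \<C> by (simp add: countable_cofinal_ideals_def)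
  ultimately show ?thesis by blast
qed

theorem proposition1p20:
  fixes K :: "('k, 'm) ring_scheme" and R :: "('k, 'a, 'n) module_scheme"
  assumes "field K" and "almost_PI K R"
  shows "(\<exists>\<C>. countable_cofinal_ideals R \<C>) \<and> (\<exists>S. countable S \<and> separating_set R S)"
proof -
  interpret assoc_algebra K R using assms(2) by (simp add: almost_PI_def)
  let ?V = "\<lambda>ws. {capelli R (x 0) (word_eval R (x \<circ> Suc)) ws |x. x \<in> UNIV \<rightarrow> carrier R}"
  \<comment> \<open>The index type \<open>nat list list\<close> is countable, so this range is
    countable whatever the cardinalities of \<open>K\<close> and \<open>R\<close>.\<close>
  let ?\<C> = "range (\<lambda>ws. genideal R (?V ws))"
  have V: "?V ws \<subseteq> carrier R" for ws
    using capelli_word_eval_closed by blast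
  have "countable_cofinal_ideals R ?\<C>"
    unfolding countable_cofinal_ideals_def
  proof (intro conjI ballI)
    show "?\<C> \<subseteq> nonzero_ideals R"
    proof
      fix I assume "I \<in> ?\<C>"
      then obtain ws where I: "I = genideal R (?V ws)" by blast
      from assms(2) have "\<not> PI_algebra K R" by (simp add: almost_PI_def)
      then obtain x where "x \<in> UNIV \<rightarrow> carrier R"
        "capelli R (x 0) (word_eval R (x \<circ> Suc)) ws \<noteq> \<zero>\<^bsub>R\<^esub>"
        by (rule capelli_nonzero_of_not_PI)
      with genideal_self[OF V[of ws]] have "I \<noteq> {\<zero>\<^bsub>R\<^esub>}" unfolding I by blast
      then show "I \<in> nonzero_ideals R"
        using genideal_ideal[OF V] by (simp add: nonzero_ideals_def I)
    qed
  next
    fix J assume "J \<in> nonzero_ideals R"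
    with assms(2) have "ideal J R" "PI_algebra K (R QuotAlg J)"
      by (auto simp: almost_PI_def nonzero_ideals_def)
    then obtain ws where
      "\<forall>x \<in> UNIV \<rightarrow> carrier R. capelli R (x 0) (word_eval R (x \<circ> Suc)) ws \<in> J"
      using capelli_mem_ideal_of_PI_quotient by blast
    \<comment> \<open>All generators lie in \<open>J\<close>, so the smallest ideal containing them
      does too.\<close>
    then have "genideal R (?V ws) \<subseteq> J"
      by (intro genideal_minimal \<open>ideal J R\<close>) blast
    then show "\<exists>I \<in> ?\<C>. I \<subseteq> J" by blast
  qed simp
  then show ?thesis using separating_set_of_cofinal_ideals[OF ring_axioms] by blast
qed

end
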